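(* Let $S=\{1,2\}$, $T>0$, $\lambda_1,\lambda_2\ge0$, let $\alpha,\beta\in(0,\infty)\setminus\{1\}$ with $\alpha<\beta$, and let $r_i,\mu_i,\sigma_i>0$ ($i\in S$) satisfy $$0<\mu_1-r_1<\mu_2-r_2,\qquad 0<\sigma_1<\sigma_2,\qquad \frac{\mu_1-r_1}{\sigma_1^2}>\frac{\mu_2-r_2}{\sigma_2^2}.$$ Let $\{g^{i,j}\}_{i,j\in S}$ be the unique positive solution on $(-\infty,T]$ of the ODE system in the context with $\alpha_1=\alpha$, $\alpha_2=\beta$, and define, for $i\in S$, $$\pi^*(t,i)=\frac{\mu_i-r_i}{\sigma_i^2}\,\frac{p(t,i,1)(g^{i,1}(t))^{\frac{\alpha}{1-\alpha}}+p(t,i,2)(g^{i,2}(t))^{\frac{\beta}{1-\beta}}}{\alpha p(t,i,1)(g^{i,1}(t))^{\frac{\alpha}{1-\alpha}}+\beta p(t,i,2)(g^{i,2}(t))^{\frac{\beta}{1-\beta}}},\qquad \pi_1^*(t,i)=\frac{\mu_i-r_i}{\alpha\sigma_i^2},\qquad \pi_2^*(t,i)=\frac{\mu_i-r_i}{\beta\sigma_i^2}.$$ Then $$\pi_2^*(t,i)<\pi^*(t,i)<\pi_1^*(t,i),\qquad\forall(t,i)\in[0,T)\times S.$$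
   Context: The ODE system, for $i,j\in S=\{1,2\}$, is $$\frac{\alpha_j}{1-\alpha_j}g^{i,j}_t(t)=\Big\{\tfrac12\alpha_j\Big(\frac{\mu_i-r_i}{\sigma_i}\Big)^2A_i^2(t)-\Big(\frac{\mu_i-r_i}{\sigma_i}\Big)^2A_i(t)-r_i+\frac{\lambda_i}{1-\alpha_j}\Big[1-\Big(\frac{g^{3-i,j}(t)}{g^{i,j}(t)}\Big)^{\alpha_j}\Big]\Big\}g^{i,j}(t),\quad g^{i,j}(T)=1,$$ where $$A_i(t)=\frac{p(t,i,1)(g^{i,1}(t))^{\alpha_1/(1-\alpha_1)}+p(t,i,2)(g^{i,2}(t))^{\alpha_2/(1-\alpha_2)}}{\alpha_1p(t,i,1)(g^{i,1}(t))^{\alpha_1/(1-\alpha_1)}+\alpha_2p(t,i,2)(g^{i,2}(t))^{\alpha_2/(1-\alpha_2)}}.$$ Here $p(t,i,j)=\mathbb{P}(\epsilon_T=j\mid\epsilon_t=i)$ are the transition probabilities of the two-state continuous-time Markov chain $\epsilon$ (regime 1 = bull market, regime 2 = bear market) with switching rates $\lambda_1$ (from 1 to 2) and $\lambda_2$ (from 2 to 1): if $\lambda_1^2+\lambda_2^2\neq0$, then $p(t,i,3-i)=\frac{\lambda_i}{\lambda_1+\lambda_2}\big[1-e^{-(\lambda_1+\lambda_2)(T-t)}\big]$ and $p(t,i,i)=1-p(t,i,3-i)$; if $\lambda_1=\lambda_2=0$, then $p(t,i,i)=1$ and $p(t,i,3-i)=0$. The paper establishes that the system has a unique positive $C^1$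 solution on $(-\infty,T]$. In regime $i$, $r_i$ is the risk-free rate, and $\mu_i,\sigma_i$ are the rate of return and volatility of the risky asset. $\pi^*(t,i)$ is the equilibrium proportion of wealth invested in the risky asset by an investor with CRRA utility whose relative risk aversion is $\alpha$ if the terminal regime is 1 and $\beta$ if it is 2; $\pi_1^*$ and $\pi_2^*$ (Merton's fractions) are the equilibrium proportions of investors with constant relative risk aversion $\alpha$ and $\beta$, respectively.
   Formalization: The strict inequalities are claimed in regime i only when λ_i > 0; if λ_i = 0 then p(t,i,3−i) = 0 and π*(t,i) equals a Merton fraction (π_1* for i = 1, π_2* for i = 2), so the printed double strict inequality fails. *)

theory Defs
  imports Complex_Main
begin

text \<open>
  Regimes are the natural numbers 1 (bull) and 2 (bear); for a regime \<open>i\<close> the other one is \<open>3 - i\<close>.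
  Values of regime-indexed functions outside \<open>regimes\<close> are irrelevant.
\<close>

definition regimes :: "nat set" where
  "regimes = {1, 2}"

definition switch_prob :: "(nat \<Rightarrow> real) \<Rightarrow> real \<Rightarrow> real \<Rightarrow> nat \<Rightarrow> real" where
  "switch_prob lam T t i =
     (if (lam 1)\<^sup>2 + (lam 2)\<^sup>2 \<noteq> 0
      then lam i / (lam 1 + lam 2) * (1 - exp (- (lam 1 + lam 2) * (T - t)))
      else 0)"

text \<open>
  \<open>trans_prob lam T t i j\<close> is the probability that the two-state chain with rates
  \<open>lam 1\<close> (from 1 to 2) and \<open>lam 2\<close> (from 2 to 1) is in \<open>j\<close> at time \<open>T\<close>, given that it is
  in \<open>i\<close> at time \<open>t\<close>. If \<open>lam i = 0\<close> the chain never leaves \<open>i\<close>; then \<open>pi_star\<close> below equals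
  the Merton fraction of the risk aversion attached to \<open>i\<close>, so strict bounds need \<open>lam i > 0\<close>.
\<close>

definition trans_prob :: "(nat \<Rightarrow> real) \<Rightarrow> real \<Rightarrow> real \<Rightarrow> nat \<Rightarrow> nat \<Rightarrow> real" where
  "trans_prob lam T t i j =
     (if j = i then 1 - switch_prob lam T t i else switch_prob lam T t i)"

definition risk_aversion :: "real \<Rightarrow> real \<Rightarrow> nat \<Rightarrow> real" where
  "risk_aversion \<alpha> \<beta> j = (if j = 1 then \<alpha> else \<beta>)"

definition A_coeff ::
  "(nat \<Rightarrow> real) \<Rightarrow> (nat \<Rightarrow> real) \<Rightarrow> real \<Rightarrow> (nat \<Rightarrow> nat \<Rightarrow> real \<Rightarrow> real) \<Rightarrow> nat \<Rightarrow> real \<Rightarrow> real" where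
  "A_coeff lam a T g i t =
     (trans_prob lam T t i 1 * g i 1 t powr (a 1 / (1 - a 1))
        + trans_prob lam T t i 2 * g i 2 t powr (a 2 / (1 - a 2)))
     / (a 1 * trans_prob lam T t i 1 * g i 1 t powr (a 1 / (1 - a 1))
        + a 2 * trans_prob lam T t i 2 * g i 2 t powr (a 2 / (1 - a 2)))"

text \<open>
  Positive \<open>C\<^sup>1\<close> solutions of the terminal value problem on \<open>(-\<infinity>, T]\<close>; the derivative
  at the right end point \<open>T\<close> is one-sided.
\<close>

definition positive_solution ::
  "(nat \<Rightarrow> real) \<Rightarrow> (nat \<Rightarrow> real) \<Rightarrow> (nat \<Rightarrow> real) \<Rightarrow> (nat \<Rightarrow> real) \<Rightarrow> (nat \<Rightarrow> real) \<Rightarrow> real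
     \<Rightarrow> (nat \<Rightarrow> nat \<Rightarrow> real \<Rightarrow> real) \<Rightarrow> bool" where
  "positive_solution mu r sigma lam a T g \<longleftrightarrow>
     (\<exists>g'. \<forall>i\<in>regimes. \<forall>j\<in>regimes.
        g i j T = 1 \<and> continuous_on {..T} (g' i j) \<and>
        (\<forall>t\<le>T.
           g i j t > 0 \<and>
           (g i j has_real_derivative g' i j t) (at t within {..T}) \<and>
           a j / (1 - a j) * g' i j t =
             (1 / 2 * a j * ((mu i - r i) / sigma i)\<^sup>2 * (A_coeff lam a T g i t)\<^sup>2
              - ((mu i - r i) / sigma i)\<^sup>2 * A_coeff lam a T g i t
              - r i
              + lam i / (1 - a j) * (1 - (g (3 - i) j t / g i j t) powr a j))
             * g i j t))"

definition pi_star ::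
  "(nat \<Rightarrow> real) \<Rightarrow> (nat \<Rightarrow> real) \<Rightarrow> (nat \<Rightarrow> real) \<Rightarrow> (nat \<Rightarrow> real) \<Rightarrow> (nat \<Rightarrow> real) \<Rightarrow> real
     \<Rightarrow> (nat \<Rightarrow> nat \<Rightarrow> real \<Rightarrow> real) \<Rightarrow> real \<Rightarrow> nat \<Rightarrow> real" where
  "pi_star mu r sigma lam a T g t i = (mu i - r i) / (sigma i)\<^sup>2 * A_coeff lam a T g i t"

text \<open>Merton's fraction for constant relative risk aversion \<open>\<gamma>\<close>; it does not depend on time.\<close>

definition merton_fraction ::
  "(nat \<Rightarrow> real) \<Rightarrow> (nat \<Rightarrow> real) \<Rightarrow> (nat \<Rightarrow> real) \<Rightarrow> real \<Rightarrow> nat \<Rightarrow> real" where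
  "merton_fraction mu r sigma \<gamma> i = (mu i - r i) / (\<gamma> * (sigma i)\<^sup>2)"

end

theory Submission
  imports Defs
begin

text \<open>All three portfolios are multiples of the same positive number \<open>k\<close>, the
  excess return over the variance in regime \<open>i\<close>: the Merton fractions with factors
  \<open>1 / \<beta>\<close> and \<open>1 / \<alpha>\<close>, the equilibrium with factor
  \<open>A_coeff\<close>. This last factor is the reciprocal of a weighted mean of \<alpha> and
  \<beta>, the weights being transition probabilities times powers of \<open>g\<close>. Both weights
  are strictly positive, since \<open>g\<close> is positive and, for \<open>lam i > 0\<close> and
  \<open>t < T\<close>, either terminal regime has positive probability. Hence the mean lies
  strictly between \<alpha> and \<beta>.\<close>

text \<open>A product of a factor in (0, 1] and one in (0, 1): \<open>lam i > 0\<close> selects the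
  nondegenerate branch and makes the rate quotient positive, and \<open>t < T\<close> puts the
  exponential strictly below 1.\<close>

lemma switch_prob_strict_bounds:
  assumes "lam 1 \<ge> 0" "lam 2 \<ge> 0" "i \<in> regimes" "lam i > 0" "t < T"
  shows "0 < switch_prob lam T t i" "switch_prob lam T t i < 1"
proof -
  define c where "c = lam 1 + lam 2"
  have nz: "(lam 1)\<^sup>2 + (lam 2)\<^sup>2 \<noteq> 0"
    using assms by (auto simp: regimes_def sum_power2_eq_zero_iff)
  have c: "0 < c" and frac: "0 < lam i / c" "lam i / c \<le> 1"
    using assms by (auto simp: regimes_def c_def)
  have e: "exp (- c * (T - t)) < 1"
    using c \<open>t < T\<close> by simp
  have eq: "switch_prob lam T t i = lam i / c * (1 - exp (- c * (T - t)))"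
    using nz by (simp add: switch_prob_def c_def)
  show "0 < switch_prob lam T t i"
    unfolding eq using frac(1) e by (intro mult_pos_pos) auto
  have "lam i / c * (1 - exp (- c * (T - t))) \<le> 1 * (1 - exp (- c * (T - t)))"
    using frac(2) e by (intro mult_right_mono) auto
  also have "\<dots> < 1" by simp
  finally show "switch_prob lam T t i < 1"
    unfolding eq .
qed

lemma trans_prob_pos:
  assumes "lam 1 \<ge> 0" "lam 2 \<ge> 0" "i \<in> regimes" "lam i > 0" "t < T"
  shows "trans_prob lam T t i j > 0"
  using switch_prob_strict_bounds[OF assms] by (simp add: trans_prob_def)

text \<open>The denominator lies strictly between \<open>a * (x + y)\<close> and
  \<open>b * (x + y)\<close>; the ratio is the reciprocal of a weighted mean of \<open>a\<close> and
  \<open>b\<close>.\<close>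

lemma weighted_ratio_strict_bounds:
  fixes a b x y :: real
  assumes "0 < a" "a < b" "0 < x" "0 < y"
  shows "1 / b < (x + y) / (a * x + b * y)" "(x + y) / (a * x + b * y) < 1 / a"
proof -
  have "0 < a * x + b * y" "a * x < b * x" "a * y < b * y"
    using assms by (simp_all add: add_pos_pos)
  \<comment> \<open>With denominators cleared, the first bound reduces to
    \<open>a * x < b * x\<close> and the second to \<open>a * y < b * y\<close>.\<close>
  then show "1 / b < (x + y) / (a * x + b * y)" "(x + y) / (a * x + b * y) < 1 / a"
    using assms by (simp_all add: divide_simps algebra_simps)
qed

theorem mainTheorem5:
  fixes T \<alpha> \<beta> :: real
    and lam mu r sigma :: "nat \<Rightarrow> real"
    and g :: "nat \<Rightarrow> nat \<Rightarrow> real \<Rightarrow> real"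
  assumes "T > 0"
    and "lam 1 \<ge> 0" and "lam 2 \<ge> 0"
    and "\<alpha> > 0" and "\<alpha> \<noteq> 1" and "\<beta> > 0" and "\<beta> \<noteq> 1" and "\<alpha> < \<beta>"
    and "\<forall>i\<in>regimes. r i > 0 \<and> mu i > 0 \<and> sigma i > 0"
    and "0 < mu 1 - r 1" and "mu 1 - r 1 < mu 2 - r 2"
    and "sigma 1 < sigma 2"
    and "(mu 1 - r 1) / (sigma 1)\<^sup>2 > (mu 2 - r 2) / (sigma 2)\<^sup>2"
    and "positive_solution mu r sigma lam (risk_aversion \<alpha> \<beta>) T g"
  shows "\<forall>t\<in>{0..<T}. \<forall>i\<in>regimes. lam i > 0 \<longrightarrow>
           merton_fraction mu r sigma \<beta> i < pi_star mu r sigma lam (risk_aversion \<alpha> \<beta>) T g t i \<and>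
           pi_star mu r sigma lam (risk_aversion \<alpha> \<beta>) T g t i < merton_fraction mu r sigma \<alpha> i"
proof (intro ballI impI)
  fix t i assume t: "t \<in> {0..<T}" and i: "i \<in> regimes" and l: "lam i > 0"
  let ?A = "A_coeff lam (risk_aversion \<alpha> \<beta>) T g i t"
  have g: "g i 1 t > 0" "g i 2 t > 0"
    using assms(14) t i by (auto simp: positive_solution_def regimes_def)
  have p: "trans_prob lam T t i j > 0" for j
    using trans_prob_pos[OF assms(2,3) i l] t by simp
  define x where "x = trans_prob lam T t i 1 * g i 1 t powr (\<alpha> / (1 - \<alpha>))"
  define y where "y = trans_prob lam T t i 2 * g i 2 t powr (\<beta> / (1 - \<beta>))"
  \<comment> \<open>Since \<open>0 powr c = 0\<close>, it is the positivity of \<open>g\<close> that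
    keeps the powers nonzero, whatever the sign of the exponents.\<close>
  have "0 < x" "0 < y"
    using p g by (simp_all add: x_def y_def)
  moreover have "?A = (x + y) / (\<alpha> * x + \<beta> * y)"
    by (simp add: A_coeff_def risk_aversion_def x_def y_def mult.assoc)
  ultimately have A: "1 / \<beta> < ?A" "?A < 1 / \<alpha>"
    using weighted_ratio_strict_bounds[of \<alpha> \<beta> x y] assms(4,8) by simp_all
  define k where "k = (mu i - r i) / (sigma i)\<^sup>2"
  \<comment> \<open>In regime 2 the positive excess return comes from the chain
    \<open>0 < mu 1 - r 1 < mu 2 - r 2\<close>.\<close>
  have k: "0 < k"
    using assms(9-11) i by (auto simp: k_def regimes_def)
  have merton: "merton_fraction mu r sigma c i = k * (1 / c)" for c
    by (simp add: merton_fraction_def k_def mult.commute)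
  have star: "pi_star mu r sigma lam (risk_aversion \<alpha> \<beta>) T g t i = k * ?A"
    by (simp add: pi_star_def k_def)
  show "merton_fraction mu r sigma \<beta> i < pi_star mu r sigma lam (risk_aversion \<alpha> \<beta>) T g t i \<and>
        pi_star mu r sigma lam (risk_aversion \<alpha> \<beta>) T g t i < merton_fraction mu r sigma \<alpha> i"
    unfolding merton star by (intro conjI mult_strict_left_mono A k)
qed

end
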